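(* Let $G$ be an FTD-admissible graph of order $n$ and let $k = 1+\lfloor \log_2 (n+1) \rfloor \ge 5$. Then $\gamma^{\mathrm{FTD}}(G) = k$ if and only if $G$ can be obtained (up to isomorphism) from some graph $G^F(k) = (C \cup (V \setminus C),E)$ for which $G^F(k)[C]$ is FTD-admissible, by removing up to $2^{k-1}-k$ vertices of $V \setminus C$.
   Context: Graphs are finite, simple and undirected. For a graph $G=(V,E)$ and $v\in V$, $N(v)$ is the open neighborhood and $N[v]=N(v)\cup\{v\}$ the closed neighborhood; $G[C]$ is the subgraph induced by $C$. Open twins are distinct non-adjacent vertices $u,v$ with $N(u)=N(v)$; closed twins are distinct adjacent vertices $u,v$ with $N[u]=N[v]$. A set $C\subseteq V$ is total-dominating if $N(v)\cap C\neq\emptyset$ for all $v\in V$, and full-separating if $N(u)\cap C\neq N(v)\cap C$ and $N[u]\cap C\neq N[v]\cap C$ for all distinct $u,v\in V$. An FTD-code is a set that is both full-separating and total-dominating. A graph is FTD-admissible if it has an FTD-code (equivalently, it has no isolated vertices, no open twins and no closed twins); $\gamma^{\mathrm{FTD}}(G)$ is the minimum cardinality of an FTD-code of $G$. For $k\ge 4$, $G^F(k)$ denotes any graph with vertex set $V$ and a subset $C\subseteq V$ such that $|C|=k$, the induced subgraph $G^F(k)[C]$ has neither open nor closed twins, and $V\setminus C$ consists of exactly one vertex $v_{C'}$ with $N(v_{C'})\cap C=C'$ for each non-empty subset $C'\subseteq C$ such that there is no vertex $u\in C$ with either $N(u)\cap C=C'$ or $N[u]\cap C=C'$; there is no condition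 on the edges inside $V\setminus C$. *)

theory Defs
  imports Complex_Main "Graph_Theory.Graph_Theory"
begin

text \<open>
  Finite simple undirected graphs are the structures satisfying the locale predicate
  \<^locale>\<open>graph\<close> of the AFP entry Graph-Theory: finite, symmetric, loop-free digraphs without
  parallel arcs. Adjacency of \<open>u\<close> and \<open>v\<close> is written \<open>u \<rightarrow>\<^bsub>G\<^esub> v\<close>,
  and \<open>G \<restriction> S\<close> is the subgraph induced by \<open>S\<close>.
\<close>

definition open_nbhd :: "('a, 'b) pre_digraph \<Rightarrow> 'a \<Rightarrow> 'a set" where
  "open_nbhd G v = {u. v \<rightarrow>\<^bsub>G\<^esub> u}"

definition closed_nbhd :: "('a, 'b) pre_digraph \<Rightarrow> 'a \<Rightarrow> 'a set" where
  "closed_nbhd G v = insert v (open_nbhd G v)"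

definition open_twins :: "('a, 'b) pre_digraph \<Rightarrow> 'a \<Rightarrow> 'a \<Rightarrow> bool" where
  "open_twins G u v \<longleftrightarrow> u \<in> verts G \<and> v \<in> verts G \<and> u \<noteq> v \<and> \<not> u \<rightarrow>\<^bsub>G\<^esub> v \<and>
     open_nbhd G u = open_nbhd G v"

definition closed_twins :: "('a, 'b) pre_digraph \<Rightarrow> 'a \<Rightarrow> 'a \<Rightarrow> bool" where
  "closed_twins G u v \<longleftrightarrow> u \<in> verts G \<and> v \<in> verts G \<and> u \<noteq> v \<and> u \<rightarrow>\<^bsub>G\<^esub> v \<and>
     closed_nbhd G u = closed_nbhd G v"

definition total_dominating :: "('a, 'b) pre_digraph \<Rightarrow> 'a set \<Rightarrow> bool" where
  "total_dominating G C \<longleftrightarrow> C \<subseteq> verts G \<and> (\<forall>v \<in> verts G. open_nbhd G v \<inter> C \<noteq> {})"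

definition full_separating :: "('a, 'b) pre_digraph \<Rightarrow> 'a set \<Rightarrow> bool" where
  "full_separating G C \<longleftrightarrow> C \<subseteq> verts G \<and>
     (\<forall>u \<in> verts G. \<forall>v \<in> verts G. u \<noteq> v \<longrightarrow>
        open_nbhd G u \<inter> C \<noteq> open_nbhd G v \<inter> C \<and>
        closed_nbhd G u \<inter> C \<noteq> closed_nbhd G v \<inter> C)"

definition FTD_code :: "('a, 'b) pre_digraph \<Rightarrow> 'a set \<Rightarrow> bool" where
  "FTD_code G C \<longleftrightarrow> full_separating G C \<and> total_dominating G C"

definition FTD_admissible :: "('a, 'b) pre_digraph \<Rightarrow> bool" where
  "FTD_admissible G \<longleftrightarrow> (\<exists>C. FTD_code G C)"

text \<open>Meaningful only if \<open>G\<close> is FTD-admissible; otherwise the value is unspecified.\<close>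

definition gamma_FTD :: "('a, 'b) pre_digraph \<Rightarrow> nat" where
  "gamma_FTD G = (LEAST m. \<exists>C. FTD_code G C \<and> card C = m)"

text \<open>
  \<open>is_GF k G C\<close>: the graph \<open>G\<close> with distinguished vertex set \<open>C\<close> is one of the graphs
  \<open>G\<^sup>F(k)\<close>. The bijection says that \<open>V \<setminus> C\<close> consists of exactly one vertex
  \<open>v\<^sub>X\<close> with \<open>N(v\<^sub>X) \<inter> C = X\<close> for each admitted set \<open>X\<close>, and of no other vertices;
  the arcs inside \<open>V \<setminus> C\<close> are unconstrained.
\<close>

definition is_GF :: "nat \<Rightarrow> ('a, 'b) pre_digraph \<Rightarrow> 'a set \<Rightarrow> bool" where
  "is_GF k G C \<longleftrightarrow> 4 \<le> k \<and> graph G \<and> C \<subseteq> verts G \<and> card C = k \<and>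
     (\<forall>u v. \<not> open_twins (G \<restriction> C) u v \<and> \<not> closed_twins (G \<restriction> C) u v) \<and>
     bij_betw (\<lambda>v. open_nbhd G v \<inter> C) (verts G - C)
       {X. X \<subseteq> C \<and> X \<noteq> {} \<and>
          \<not> (\<exists>u \<in> C. open_nbhd G u \<inter> C = X \<or> closed_nbhd G u \<inter> C = X)}"

text \<open>
  \<open>obtained_from_GF k G\<close>: up to isomorphism, \<open>G\<close> arises from some \<open>G\<^sup>F(k)\<close> whose subgraph
  induced by \<open>C\<close> is FTD-admissible by removing a set \<open>R\<close> of at most \<open>2\<^sup>k\<^sup>-\<^sup>1 - k\<close> vertices
  outside \<open>C\<close>. The graph \<open>H\<close> may have more vertices than the vertex type of \<open>G\<close> has
  elements, so it lives on natural numbers; this loses nothing, since every finite simple graph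
  is isomorphic to one whose vertices are naturals and whose arcs are pairs of them. The natural
  number subtraction does not truncate, as \<open>is_GF\<close> forces \<open>k \<ge> 4\<close>.
\<close>

definition obtained_from_GF :: "nat \<Rightarrow> ('a, 'b) pre_digraph \<Rightarrow> bool" where
  "obtained_from_GF k G \<longleftrightarrow>
     (\<exists>(H :: (nat, nat \<times> nat) pre_digraph) C R.
        is_GF k H C \<and> FTD_admissible (H \<restriction> C) \<and>
        R \<subseteq> verts H - C \<and> card R \<le> 2 ^ (k - 1) - k \<and>
        digraph_iso (H \<restriction> (verts H - R)) G)"

end

theory Submission
  imports Defs
begin

text \<open>
  For an FTD-code \<open>C\<close>, the traces \<open>N(v) \<inter> C\<close> of all vertices \<open>v\<close> and the traces
  \<open>N[v] \<inter> C\<close> of the vertices \<open>v \<in> C\<close> are pairwise distinct non-empty subsets of \<open>C\<close>, so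
  \<open>n + |C| \<le> 2\<^sup>|\<^sup>C\<^sup>| - 1\<close>; hence no code has fewer than \<open>k\<close> elements. Given a code
  of size \<open>k\<close>, adding one vertex for each non-empty subset of \<open>C\<close> that is not a trace yields a graph
  \<open>G\<^sup>F(k)\<close>, and at most \<open>2\<^sup>k\<^sup>-\<^sup>1 - k\<close> subsets are missing because \<open>n \<ge> 2\<^sup>k\<^sup>-\<^sup>1 - 1\<close>.
  Conversely, \<open>C\<close> is an FTD-code of \<open>G\<^sup>F(k)\<close> and remains one when vertices outside \<open>C\<close>
  are removed.
\<close>

section \<open>Neighborhoods and FTD-codes in induced subgraphs and isomorphic copies\<close>

lemma open_nbhd_subset_verts:
  assumes "graph G"
  shows "open_nbhd G v \<subseteq> verts G"
proof -
  interpret graph G by fact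
  show ?thesis by (auto simp: open_nbhd_def)
qed

lemma open_nbhd_sym:
  assumes "graph G"
  shows "u \<in> open_nbhd G v \<longleftrightarrow> v \<in> open_nbhd G u"
proof -
  interpret graph G by fact
  show ?thesis
    using sym_arcs by (auto simp: open_nbhd_def symmetric_def sym_def)
qed

lemma open_nbhd_irrefl:
  assumes "graph G"
  shows "v \<notin> open_nbhd G v"
proof -
  interpret graph G by fact
  show ?thesis by (auto simp: open_nbhd_def arcs_ends_conv dest: no_loops)
qed

text \<open>If \<open>u = v\<close>, then \<open>v\<close> lies in the right-hand trace only.
  Otherwise equality would make \<open>v\<close> a neighbor of \<open>u\<close>, hence by symmetry
  put \<open>u\<close> into the right-hand trace, and so make \<open>u\<close> a neighbor of
  itself.\<close>

lemma open_nbhd_neq_closed_nbhd: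
  assumes "graph G" "u \<in> C" "v \<in> C"
  shows "open_nbhd G u \<inter> C \<noteq> closed_nbhd G v \<inter> C"
  using assms open_nbhd_sym[of G u v] open_nbhd_irrefl[of G u]
  by (auto simp: closed_nbhd_def)

lemma closed_nbhd_Int_notin:
  assumes "v \<notin> C"
  shows "closed_nbhd G v \<inter> C = open_nbhd G v \<inter> C"
  using assms by (auto simp: closed_nbhd_def)

lemma open_nbhd_induce:
  assumes "v \<in> S"
  shows "open_nbhd (G \<restriction> S) v = open_nbhd G v \<inter> S"
  using assms by (auto simp: open_nbhd_def arcs_ends_conv)

lemma closed_nbhd_induce:
  assumes "v \<in> S"
  shows "closed_nbhd (G \<restriction> S) v = closed_nbhd G v \<inter> S"
  using assms by (auto simp: closed_nbhd_def open_nbhd_induce)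

lemma induce_induce:
  assumes "T \<subseteq> S"
  shows "(G \<restriction> S) \<restriction> T = G \<restriction> T"
  using assms by (auto simp: induce_subgraph_def)

text \<open>Both code conditions see only traces on \<open>C\<close>, and inducing on a superset of
  \<open>C\<close> leaves these unchanged.\<close>

lemma FTD_code_induce:
  assumes "FTD_code G C" "C \<subseteq> S" "S \<subseteq> verts G"
  shows "FTD_code (G \<restriction> S) C"
proof -
  have "open_nbhd (G \<restriction> S) v \<inter> C = open_nbhd G v \<inter> C"
    and "closed_nbhd (G \<restriction> S) v \<inter> C = closed_nbhd G v \<inter> C" if "v \<in> S" for v
    using that assms(2) by (auto simp: open_nbhd_induce closed_nbhd_induce)
  then show ?thesis
    using assms unfolding FTD_code_def full_separating_def total_dominating_def
    by (simp add: subset_iff)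
qed

text \<open>Traces on \<open>D\<close> are determined by traces on \<open>C\<close>, so separation
  and domination survive enlarging the code.\<close>

lemma FTD_code_superset:
  assumes "FTD_code G D" "D \<subseteq> C" "C \<subseteq> verts G"
  shows "FTD_code G C"
proof -
  have *: "X \<inter> D = Y \<inter> D" if "X \<inter> C = Y \<inter> C" for X Y :: "'a set"
    using that assms(2) by blast
  show ?thesis
    using assms * unfolding FTD_code_def full_separating_def total_dominating_def
    by (metis Int_empty_left)
qed

lemma FTD_admissible_no_twins:
  assumes "FTD_admissible G"
  shows "\<not> open_twins G u v" "\<not> closed_twins G u v"
  using assms
  unfolding FTD_admissible_def FTD_code_def full_separating_def open_twins_def closed_twins_def
  by metis+

lemma FTD_code_app_iso:
  assumes "wf_digraph G" and iso: "pre_digraph.digraph_isomorphism G f" and C: "FTD_code G C"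
  shows "FTD_code (app_iso f G) (iso_verts f ` C)"
proof -
  interpret wf_digraph G by fact
  let ?f = "iso_verts f"
  have inj: "inj_on ?f (verts G)"
    using iso by (rule digraph_isomorphism_inj_on_verts)
  have CV: "C \<subseteq> verts G"
    using C by (simp add: FTD_code_def full_separating_def)
  have sub: "open_nbhd G v \<subseteq> verts G" for v
    by (auto simp: open_nbhd_def)
  have opn: "open_nbhd (app_iso f G) (?f v) = ?f ` open_nbhd G v" if "v \<in> verts G" for v
    using that iso
    by (force simp: open_nbhd_def arcs_ends_app_iso_eq image_iff adj_in_verts)
  have trace_open: "open_nbhd (app_iso f G) (?f v) \<inter> ?f ` C = ?f ` (open_nbhd G v \<inter> C)"
    if "v \<in> verts G" for v
    using inj_on_image_Int[OF inj sub CV] opn[OF that] by simp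
  have trace_closed: "closed_nbhd (app_iso f G) (?f v) \<inter> ?f ` C = ?f ` (closed_nbhd G v \<inter> C)"
    if "v \<in> verts G" for v
    using inj_on_image_Int[OF inj, of "closed_nbhd G v" C] sub[of v] CV opn[OF that] that
    by (simp add: closed_nbhd_def)
  have inj_image: "?f ` (X \<inter> C) = ?f ` (Y \<inter> C) \<longleftrightarrow> X \<inter> C = Y \<inter> C" for X Y
    using inj CV by (intro inj_on_image_eq_iff) auto
  show ?thesis
    using C CV unfolding FTD_code_def full_separating_def total_dominating_def
    by (auto simp: trace_open trace_closed inj_image)
qed

section \<open>Traces of a code\<close>

definition open_traces :: "('a, 'b) pre_digraph \<Rightarrow> 'a set \<Rightarrow> 'a set set" where
  "open_traces G C = (\<lambda>v. open_nbhd G v \<inter> C) ` verts G"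

text \<open>Only vertices of \<open>C\<close> are taken, because closed and open traces agree at
  vertices outside \<open>C\<close>.\<close>

definition closed_traces :: "('a, 'b) pre_digraph \<Rightarrow> 'a set \<Rightarrow> 'a set set" where
  "closed_traces G C = (\<lambda>v. closed_nbhd G v \<inter> C) ` C"

text \<open>These are the sets for which the completion below adds a vertex.\<close>

definition free_traces :: "('a, 'b) pre_digraph \<Rightarrow> 'a set \<Rightarrow> 'a set set" where
  "free_traces G C = Pow C - {{}} - (open_traces G C \<union> closed_traces G C)"

lemma traces_subset:
  assumes "FTD_code G C"
  shows "open_traces G C \<union> closed_traces G C \<subseteq> Pow C - {{}}"
  using assms
  by (auto simp: open_traces_def closed_traces_def FTD_code_def total_dominating_def closed_nbhd_def)

lemma card_traces:
  assumes "graph G" and C: "FTD_code G C"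
  shows "card (open_traces G C \<union> closed_traces G C) = card (verts G) + card C"
proof -
  interpret graph G by fact
  have sep: "C \<subseteq> verts G"
      "\<And>u v. u \<in> verts G \<Longrightarrow> v \<in> verts G \<Longrightarrow> u \<noteq> v \<Longrightarrow>
        open_nbhd G u \<inter> C \<noteq> open_nbhd G v \<inter> C \<and> closed_nbhd G u \<inter> C \<noteq> closed_nbhd G v \<inter> C"
    using C by (auto simp: FTD_code_def full_separating_def)
  have "finite C" using sep(1) finite_verts by (rule finite_subset)
  have "open_nbhd G u \<inter> C \<noteq> closed_nbhd G v \<inter> C" if "u \<in> verts G" "v \<in> C" for u v
  proof (cases "u \<in> C")
    case True
    then show ?thesis using that by (intro open_nbhd_neq_closed_nbhd \<open>graph G\<close>)
  next
    \<comment> \<open>Now the open trace of \<open>u\<close> is also its closed trace, and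
      \<open>u\<close> differs from \<open>v\<close>, so closed separation applies.\<close>
    case False
    then show ?thesis using sep(1) sep(2)[of u v] that closed_nbhd_Int_notin[of u C G] by auto
  qed
  then have "open_traces G C \<inter> closed_traces G C = {}"
    by (auto simp: open_traces_def closed_traces_def)
  moreover have "inj_on (\<lambda>v. open_nbhd G v \<inter> C) (verts G)"
    using sep(2) by (auto simp: inj_on_def)
  then have "card (open_traces G C) = card (verts G)"
    unfolding open_traces_def by (rule card_image)
  moreover have "inj_on (\<lambda>v. closed_nbhd G v \<inter> C) C"
    using sep(2) by (intro inj_on_subset[OF _ sep(1)]) (auto simp: inj_on_def)
  then have "card (closed_traces G C) = card C"
    unfolding closed_traces_def by (rule card_image)
  ultimately show ?thesis
    using \<open>finite C\<close> by (subst card_Un_disjoint) (auto simp: open_traces_def closed_traces_def)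
qed

text \<open>The summand 1 counts the empty set. The additive form avoids truncated
  subtraction.\<close>

lemma card_free_traces:
  assumes "graph G" and C: "FTD_code G C"
  shows "card (free_traces G C) + card (verts G) + card C + 1 = 2 ^ card C"
proof -
  interpret graph G by fact
  have "finite C"
    using C finite_subset[OF _ finite_verts] by (auto simp: FTD_code_def full_separating_def)
  let ?T = "open_traces G C \<union> closed_traces G C"
  have "card (Pow C - {{}}) + 1 = 2 ^ card C"
    using \<open>finite C\<close> by (simp add: card_Pow)
  moreover have "card (free_traces G C) = card (Pow C - {{}}) - card ?T"
    unfolding free_traces_def
    using traces_subset[OF C] \<open>finite C\<close> by (intro card_Diff_subset) (auto intro: finite_subset)
  moreover have "card ?T \<le> card (Pow C - {{}})"
    using traces_subset[OF C] \<open>finite C\<close> by (intro card_mono) auto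
  ultimately show ?thesis
    using card_traces[OF assms] by simp
qed

text \<open>A smaller code has too few non-empty subsets to hold all traces. Positivity of
  \<open>m\<close> excludes the empty code of the empty graph.\<close>

lemma card_FTD_code_ge:
  assumes "graph G" and C: "FTD_code G C" and "2 ^ m \<le> card (verts G) + 1" and "0 < m"
  shows "m < card C"
proof (rule ccontr)
  interpret graph G by fact
  assume "\<not> m < card C"
  then have "(2::nat) ^ card C \<le> 2 ^ m" by (intro power_increasing) auto
  \<comment> \<open>Counting traces gives \<open>card (verts G) + card C + 1 \<le> 2 ^ card C \<le>
    2 ^ m \<le> card (verts G) + 1\<close>.\<close>
  then have "card C = 0"
    using card_free_traces[OF \<open>graph G\<close> C] assms(3) by linarith
  moreover have "(2::nat) \<le> 2 ^ m"
    using \<open>0 < m\<close> by (metis One_nat_def Suc_leI one_le_numeral power_increasing power_one_right)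
  ultimately show False
    using card_free_traces[OF \<open>graph G\<close> C] assms(3) by simp
qed

section \<open>Codes of the graphs \<open>G\<^sup>F(k)\<close>\<close>

text \<open>Admissibility of the subgraph induced by \<open>C\<close> settles the vertices of
  \<open>C\<close>. The bijection settles the others: their traces are non-empty, pairwise distinct
  and different from every trace of a vertex of \<open>C\<close>.\<close>

lemma is_GF_FTD_code:
  assumes GF: "is_GF k H C" and adm: "FTD_admissible (H \<restriction> C)"
  shows "FTD_code H C"
proof -
  have H: "graph H" and CV: "C \<subseteq> verts H"
    and bij: "bij_betw (\<lambda>v. open_nbhd H v \<inter> C) (verts H - C)
       {X. X \<subseteq> C \<and> X \<noteq> {} \<and> \<not> (\<exists>u \<in> C. open_nbhd H u \<inter> C = X \<or> closed_nbhd H u \<inter> C = X)}"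
    using GF by (auto simp: is_GF_def)
  obtain D where D: "FTD_code (H \<restriction> C) D" using adm by (auto simp: FTD_admissible_def)
  then have "D \<subseteq> C" by (simp add: FTD_code_def full_separating_def)
  \<comment> \<open>Enlarging the code to all of \<open>C\<close> turns neighborhoods in the induced
    subgraph into traces of \<open>H\<close> on \<open>C\<close>.\<close>
  then have codeC: "FTD_code (H \<restriction> C) C" using FTD_code_superset[OF D] by simp
  have inn: "open_nbhd H u \<inter> C \<noteq> open_nbhd H v \<inter> C \<and> closed_nbhd H u \<inter> C \<noteq> closed_nbhd H v \<inter> C"
    if "u \<in> C" "v \<in> C" "u \<noteq> v" for u v
    using codeC that unfolding FTD_code_def full_separating_def
    by (simp add: open_nbhd_induce closed_nbhd_induce)
  have dom_inn: "open_nbhd H v \<inter> C \<noteq> {}" if "v \<in> C" for v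
    using codeC that unfolding FTD_code_def total_dominating_def
    by (simp add: open_nbhd_induce)
  have out: "open_nbhd H v \<inter> C \<noteq> {}"
    "u \<in> C \<Longrightarrow> open_nbhd H u \<inter> C \<noteq> open_nbhd H v \<inter> C"
    "u \<in> C \<Longrightarrow> closed_nbhd H u \<inter> C \<noteq> open_nbhd H v \<inter> C"
    if "v \<in> verts H - C" for u v
    using bij_betwE[OF bij] that by blast+
  have out_out: "open_nbhd H u \<inter> C \<noteq> open_nbhd H v \<inter> C"
    if "u \<in> verts H - C" "v \<in> verts H - C" "u \<noteq> v" for u v
    using bij_betw_imp_inj_on[OF bij] that by (auto dest: inj_onD)
  have "open_nbhd H u \<inter> C \<noteq> open_nbhd H v \<inter> C \<and> closed_nbhd H u \<inter> C \<noteq> closed_nbhd H v \<inter> C"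
    if uv: "u \<in> verts H" "v \<in> verts H" "u \<noteq> v" for u v
  proof -
    consider "u \<in> C" "v \<in> C" | "u \<in> C" "v \<notin> C" | "u \<notin> C" "v \<in> C" | "u \<notin> C" "v \<notin> C"
      by blast
    then show ?thesis
    proof cases
      case 1
      then show ?thesis using inn uv by blast
    next
      case 2
      then show ?thesis using out(2,3)[of v u] closed_nbhd_Int_notin[of v C H] uv by simp
    next
      case 3
      then show ?thesis using out(2,3)[of u v] closed_nbhd_Int_notin[of u C H] uv by (auto dest: sym)
    next
      case 4
      then show ?thesis using out_out[of u v] closed_nbhd_Int_notin[of _ C H] uv by simp
    qed
  qed
  moreover have "open_nbhd H v \<inter> C \<noteq> {}" if "v \<in> verts H" for v
    using that dom_inn out(1) by blast
  ultimately show ?thesis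
    using CV by (simp add: FTD_code_def full_separating_def total_dominating_def)
qed

text \<open>The removed vertices avoid \<open>C\<close>, so \<open>C\<close> remains a code; the
  isomorphism carries it to a code of \<open>G\<close> of the same size.\<close>

lemma obtained_from_GF_imp_FTD_code:
  assumes "obtained_from_GF k G"
  shows "\<exists>C. FTD_code G C \<and> card C = k"
proof -
  obtain H :: "(nat, nat \<times> nat) pre_digraph" and C R where
    GF: "is_GF k H C" and adm: "FTD_admissible (H \<restriction> C)" and R: "R \<subseteq> verts H - C"
    and "digraph_iso (H \<restriction> (verts H - R)) G"
    using assms unfolding obtained_from_GF_def by blast
  then obtain f where iso: "pre_digraph.digraph_isomorphism (H \<restriction> (verts H - R)) f"
    and G: "G = app_iso f (H \<restriction> (verts H - R))"
    by (auto simp: digraph_iso_def)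
  have CV: "C \<subseteq> verts H - R" and card: "card C = k"
    using GF R by (auto simp: is_GF_def)
  interpret H: graph H using GF by (simp add: is_GF_def)
  have "FTD_code G (iso_verts f ` C)"
    unfolding G using iso is_GF_FTD_code[OF GF adm] CV
    by (intro FTD_code_app_iso FTD_code_induce) auto
  moreover have "inj_on (iso_verts f) (verts H - R)"
    using pre_digraph.digraph_isomorphism_inj_on_verts[OF iso] by simp
  then have "card (iso_verts f ` C) = k"
    using CV card by (metis card_image inj_on_subset)
  ultimately show ?thesis by blast
qed

section \<open>Completing a graph to some \<open>G\<^sup>F(k)\<close>\<close>

text \<open>\<open>Inl\<close> marks the vertices of \<open>G\<close>, and each free set
  \<open>X\<close> serves as its own new vertex \<open>Inr X\<close> with neighborhood
  \<open>X\<close>. New vertices are pairwise non-adjacent, which is allowed as edges outside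
  \<open>C\<close> are unconstrained.\<close>

definition completion_arcs :: "('a, 'b) pre_digraph \<Rightarrow> 'a set \<Rightarrow> (('a + 'a set) \<times> ('a + 'a set)) set" where
  "completion_arcs G C = map_prod Inl Inl ` arcs_ends G
     \<union> {(Inl x, Inr X) | x X. X \<in> free_traces G C \<and> x \<in> X}
     \<union> {(Inr X, Inl x) | x X. X \<in> free_traces G C \<and> x \<in> X}"

text \<open>The coding \<open>f\<close> moves the vertices to naturals, as
  \<open>obtained_from_GF\<close> demands; taking arcs to be pairs excludes parallel arcs.\<close>

definition completion :: "('a + 'a set \<Rightarrow> nat) \<Rightarrow> ('a, 'b) pre_digraph \<Rightarrow> 'a set \<Rightarrow>
    (nat, nat \<times> nat) pre_digraph" where
  "completion f G C = \<lparr> verts = f ` (verts G <+> free_traces G C),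
     arcs = map_prod f f ` completion_arcs G C, tail = fst, head = snd \<rparr>"

text \<open>Injectivity is asked on the vertex set only, since the whole sum type need not embed
  into the naturals.\<close>

locale code_completion =
  fixes G :: "('a, 'b) pre_digraph" and C :: "'a set" and f :: "'a + 'a set \<Rightarrow> nat"
  assumes graph: "graph G" and code: "FTD_code G C"
    and inj: "inj_on f (verts G <+> free_traces G C)"
begin

sublocale graph G by (rule graph)

abbreviation "H \<equiv> completion f G C"
abbreviation "M \<equiv> free_traces G C"
abbreviation \<phi> where "\<phi> v \<equiv> f (Inl v)"
abbreviation \<psi> where "\<psi> X \<equiv> f (Inr X)"

lemma C_subset: "C \<subseteq> verts G"
  using code by (simp add: FTD_code_def full_separating_def)

lemma finite_C: "finite C"
  using C_subset finite_verts by (rule finite_subset)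

lemma free_subset: "X \<in> M \<Longrightarrow> X \<subseteq> C"
  by (auto simp: free_traces_def)

lemma finite_free: "finite M"
  using finite_C by (simp add: free_traces_def)

lemma \<phi>_inj: "inj_on \<phi> (verts G)"
  using inj by (auto simp: inj_on_def)

lemma \<psi>_inj: "inj_on \<psi> M"
  using inj by (auto simp: inj_on_def)

lemma \<phi>_neq_\<psi>: "v \<in> verts G \<Longrightarrow> X \<in> M \<Longrightarrow> \<phi> v \<noteq> \<psi> X"
  using inj by (auto simp: inj_on_def)

lemma \<psi>_notin: "X \<in> M \<Longrightarrow> \<psi> X \<notin> \<phi> ` verts G"
  using \<phi>_neq_\<psi> by (metis imageE)

lemma verts_completion: "verts H = \<phi> ` verts G \<union> \<psi> ` M"
  by (simp add: completion_def Plus_def image_Un image_image)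

lemma completion_arcs_subset:
  "completion_arcs G C \<subseteq> (verts G <+> M) \<times> (verts G <+> M)"
  using free_subset C_subset by (auto simp: completion_arcs_def)

lemma arcs_ends_completion: "arcs_ends H = map_prod f f ` completion_arcs G C"
  by (auto simp: completion_def arcs_ends_conv)

lemma graph_completion: "graph H"
proof
  show "finite (verts H)"
    by (simp add: verts_completion finite_free)
  show "finite (arcs H)"
    using finite_subset[OF completion_arcs_subset] finite_free by (simp add: completion_def)
  show "tail H e \<in> verts H" "head H e \<in> verts H" if "e \<in> arcs H" for e
    using that completion_arcs_subset by (force simp: completion_def)+
  show "e1 = e2" if "arc_to_ends H e1 = arc_to_ends H e2" for e1 e2
    using that by (simp add: arc_to_ends_def completion_def prod_eq_iff)
  show "tail H e \<noteq> head H e" if e: "e \<in> arcs H" for e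
  proof -
    obtain x y where xy: "(x, y) \<in> completion_arcs G C" "e = (f x, f y)"
      using e by (auto simp: completion_def)
    have "x \<noteq> y"
      using xy(1) no_loops by (auto simp: completion_arcs_def arcs_ends_conv)
    then show ?thesis
      using xy inj_on_eq_iff[OF inj, of x y] completion_arcs_subset by (auto simp: completion_def)
  qed
  have "sym (completion_arcs G C)"
    using sym_arcs by (auto simp: completion_arcs_def symmetric_def sym_def)
  then show "symmetric H"
    unfolding symmetric_def arcs_ends_completion sym_def by auto
qed

section \<open>Traces in the completion\<close>

lemma open_nbhd_completion:
  assumes "w \<in> verts G <+> M"
  shows "open_nbhd H (f w) = f ` (completion_arcs G C `` {w})"
proof -
  have "w' = w" if "f w = f w'" "(w', z) \<in> completion_arcs G C" for w' z
    using inj_on_eq_iff[OF inj, of w w'] that assms completion_arcs_subset by auto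
  then show ?thesis
    unfolding open_nbhd_def arcs_ends_completion by (fastforce simp: map_prod_def image_iff)
qed

text \<open>An old vertex may gain new neighbors, but these lie outside the image of
  \<open>C\<close> and so do not change its trace.\<close>

lemma trace_old:
  assumes "v \<in> verts G"
  shows "open_nbhd H (\<phi> v) \<inter> \<phi> ` C = \<phi> ` (open_nbhd G v \<inter> C)"
proof -
  have "completion_arcs G C `` {Inl v} = Inl ` open_nbhd G v \<union> Inr ` {X \<in> M. v \<in> X}"
    by (auto simp: completion_arcs_def open_nbhd_def)
  then have "open_nbhd H (\<phi> v) = \<phi> ` open_nbhd G v \<union> \<psi> ` {X \<in> M. v \<in> X}"
    using open_nbhd_completion[of "Inl v"] assms by (simp add: image_Un image_image InlI)
  moreover have "\<phi> ` open_nbhd G v \<inter> \<phi> ` C = \<phi> ` (open_nbhd G v \<inter> C)"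
    using inj_on_image_Int[OF \<phi>_inj open_nbhd_subset_verts[OF graph] C_subset] by simp
  ultimately show ?thesis
    using \<phi>_neq_\<psi> C_subset by blast
qed

lemma trace_new:
  assumes "X \<in> M"
  shows "open_nbhd H (\<psi> X) \<inter> \<phi> ` C = \<phi> ` X"
proof -
  have "completion_arcs G C `` {Inr X} = Inl ` X"
    using assms by (auto simp: completion_arcs_def)
  then show ?thesis
    using open_nbhd_completion[of "Inr X"] assms free_subset[OF assms]
    by (auto simp: image_image InrI)
qed

lemma closed_trace_old:
  assumes "v \<in> C"
  shows "closed_nbhd H (\<phi> v) \<inter> \<phi> ` C = \<phi> ` (closed_nbhd G v \<inter> C)"
  using trace_old[of v] assms C_subset by (auto simp: closed_nbhd_def)

section \<open>The copy of \<open>G\<close> inside the completion\<close>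

lemma iso_completion:
  "\<exists>h. digraph_isomorphism h \<and> iso_verts h = \<phi> \<and> app_iso h G = H \<restriction> (\<phi> ` verts G)"
proof -
  let ?h = "\<lparr> iso_verts = \<phi>, iso_arcs = (\<lambda>e. (\<phi> (tail G e), \<phi> (head G e))),
    iso_head = snd, iso_tail = fst \<rparr>"
  \<comment> \<open>Without parallel arcs, an arc is determined by its ends and can be renamed to a
    pair.\<close>
  have "inj_on (iso_arcs ?h) (arcs G)"
    using \<phi>_inj no_multi_arcs by (auto simp: inj_on_def arc_to_ends_def)
  then have "digraph_isomorphism ?h"
    using \<phi>_inj by (simp add: digraph_isomorphism_def wf_digraph)
  moreover have "app_iso ?h G = H \<restriction> (\<phi> ` verts G)"
  proof -
    have "(\<lambda>e. (\<phi> (tail G e), \<phi> (head G e))) ` arcs G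
        = {e \<in> map_prod f f ` completion_arcs G C. fst e \<in> \<phi> ` verts G \<and> snd e \<in> \<phi> ` verts G}"
      (is "_ = ?A")
    proof -
      have "?A \<subseteq> map_prod \<phi> \<phi> ` arcs_ends G"
      proof
        fix e assume "e \<in> ?A"
        then obtain x y where xy: "(x, y) \<in> completion_arcs G C" "e = (f x, f y)"
          by auto
        then have old: "f x \<in> \<phi> ` verts G" "f y \<in> \<phi> ` verts G"
          using \<open>e \<in> ?A\<close> by auto
        \<comment> \<open>Both ends are old vertices, which leaves only arcs inherited from
          \<open>G\<close>.\<close>
        have "x \<noteq> Inr X" "y \<noteq> Inr X" if "X \<in> M" for X
          using old \<psi>_notin[OF that] by metis+
        then obtain u v where "(u, v) \<in> arcs_ends G" "x = Inl u" "y = Inl v"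
          using xy(1) by (auto simp: completion_arcs_def)
        then show "e \<in> map_prod \<phi> \<phi> ` arcs_ends G"
          using xy(2) by (force intro: rev_image_eqI)
      qed
      moreover have "map_prod \<phi> \<phi> ` arcs_ends G \<subseteq> ?A"
      proof -
        have "map_prod \<phi> \<phi> ` arcs_ends G = map_prod f f ` map_prod Inl Inl ` arcs_ends G"
          by (simp add: image_image map_prod_def split_def)
        then have "map_prod \<phi> \<phi> ` arcs_ends G \<subseteq> map_prod f f ` completion_arcs G C"
          by (simp add: completion_arcs_def image_Un le_supI1)
        moreover have "fst e \<in> \<phi> ` verts G \<and> snd e \<in> \<phi> ` verts G"
          if "e \<in> map_prod \<phi> \<phi> ` arcs_ends G" for e
          using that by (auto simp: adj_in_verts)
        ultimately show ?thesis by blast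
      qed
      moreover have "map_prod \<phi> \<phi> ` arcs_ends G = (\<lambda>e. (\<phi> (tail G e), \<phi> (head G e))) ` arcs G"
        by (simp add: arcs_ends_conv image_image)
      ultimately show ?thesis by simp
    qed
    then show ?thesis
      by (simp add: app_iso_def induce_subgraph_def completion_def)
  qed
  ultimately show ?thesis by (intro exI[of _ ?h]) simp
qed

section \<open>The completion as a graph \<open>G\<^sup>F(k)\<close>\<close>

lemma FTD_code_completion: "FTD_code (H \<restriction> (\<phi> ` verts G)) (\<phi> ` C)"
  using iso_completion FTD_code_app_iso[OF wf_digraph _ code] by metis

lemma FTD_admissible_completion: "FTD_admissible (H \<restriction> (\<phi> ` C))"
  using FTD_code_induce[OF FTD_code_completion order_refl] C_subset
  by (auto simp: FTD_admissible_def induce_induce image_mono)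

lemma completion_is_GF:
  assumes "4 \<le> card C"
  shows "is_GF (card C) H (\<phi> ` C)"
proof -
  define T where
    "T = {X. X \<subseteq> C \<and> X \<noteq> {} \<and> \<not> (\<exists>u \<in> C. open_nbhd G u \<inter> C = X \<or> closed_nbhd G u \<inter> C = X)}"
  have sep: "open_nbhd G u \<inter> C \<noteq> open_nbhd G v \<inter> C" "closed_nbhd G u \<inter> C \<noteq> closed_nbhd G v \<inter> C"
    if "u \<in> verts G" "v \<in> verts G" "u \<noteq> v" for u v
    using code that by (auto simp: FTD_code_def full_separating_def)
  have dom: "open_nbhd G v \<inter> C \<noteq> {}" if "v \<in> verts G" for v
    using code that by (auto simp: FTD_code_def total_dominating_def)
  have image_eq: "\<phi> ` X = \<phi> ` Y \<longleftrightarrow> X = Y" if "X \<subseteq> C" "Y \<subseteq> C" for X Y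
    using that inj_on_subset[OF \<phi>_inj C_subset] by (intro inj_on_image_eq_iff) auto
  have T_eq: "{X. X \<subseteq> \<phi> ` C \<and> X \<noteq> {} \<and> \<not> (\<exists>u \<in> \<phi> ` C. open_nbhd H u \<inter> \<phi> ` C = X
      \<or> closed_nbhd H u \<inter> \<phi> ` C = X)} = (`) \<phi> ` T" (is "?T' = _")
  proof -
    have "X \<in> ?T' \<longleftrightarrow> X \<in> (`) \<phi> ` T" for X
    proof (cases "X \<subseteq> \<phi> ` C")
      case True
      then obtain Y where Y: "Y \<subseteq> C" "X = \<phi> ` Y" by (auto simp: subset_image_iff)
      have "X \<in> ?T' \<longleftrightarrow> Y \<in> T"
        using Y C_subset by (auto simp: T_def trace_old closed_trace_old image_eq subset_iff)
      moreover have "X \<in> (`) \<phi> ` T \<longleftrightarrow> Y \<in> T"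
      proof
        assume "X \<in> (`) \<phi> ` T"
        then obtain Z where "Z \<in> T" "\<phi> ` Z = \<phi> ` Y" using Y by auto
        moreover from this have "Z \<subseteq> C" by (simp add: T_def)
        ultimately show "Y \<in> T" using image_eq Y by metis
      qed (use Y in auto)
      ultimately show ?thesis by simp
    qed (auto simp: T_def)
    then show ?thesis by (rule set_eqI)
  qed
  have V: "verts H - \<phi> ` C = \<phi> ` (verts G - C) \<union> \<psi> ` M"
    using \<phi>_neq_\<psi> C_subset \<phi>_inj inj_on_image_set_diff[OF \<phi>_inj, of "verts G" C]
    by (auto simp: verts_completion)
  let ?N = "\<lambda>v. open_nbhd H v \<inter> \<phi> ` C"
  have "open_nbhd G v \<inter> C \<in> T" if v: "v \<in> verts G - C" for v
    using v dom[of v] sep(1)[of _ v] sep(2)[of _ v] C_subset closed_nbhd_Int_notin[of v C G]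
    by (auto simp: T_def)
  moreover have "M \<subseteq> T"
    using C_subset by (auto simp: free_traces_def open_traces_def closed_traces_def T_def)
  moreover have "X \<in> (\<lambda>v. open_nbhd G v \<inter> C) ` (verts G - C)" if "X \<in> T" "X \<notin> M" for X
    using that by (auto simp: free_traces_def open_traces_def closed_traces_def T_def)
  ultimately have T_split: "T = (\<lambda>v. open_nbhd G v \<inter> C) ` (verts G - C) \<union> M"
    by blast
  have "?N ` (verts H - \<phi> ` C) = (`) \<phi> ` T"
    by (auto simp: V T_split image_Un image_image trace_old trace_new)
  moreover have "inj_on ?N (verts H - \<phi> ` C)"
  proof -
    have "inj_on ?N (\<phi> ` (verts G - C))"
    proof (rule inj_onI, clarsimp simp: trace_old)
      fix u v assume uv: "u \<in> verts G" "v \<in> verts G"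
        "\<phi> ` (open_nbhd G u \<inter> C) = \<phi> ` (open_nbhd G v \<inter> C)"
      then have "open_nbhd G u \<inter> C = open_nbhd G v \<inter> C" using image_eq by blast
      then show "\<phi> u = \<phi> v" using sep(1) uv by metis
    qed
    moreover have "inj_on ?N (\<psi> ` M)"
      by (rule inj_onI) (auto simp: trace_new image_eq free_subset)
    \<comment> \<open>An old and a new vertex cannot share a trace, because a free set is no trace
      of \<open>G\<close>.\<close>
    moreover have "?N (\<phi> v) \<noteq> ?N (\<psi> X)" if "v \<in> verts G - C" "X \<in> M" for v X
    proof -
      have "open_nbhd G v \<inter> C \<noteq> X"
        using that by (auto simp: free_traces_def open_traces_def)
      then show ?thesis
        using that image_eq free_subset by (simp add: trace_old trace_new)
    qed
    ultimately show ?thesis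
      unfolding V inj_on_Un by blast
  qed
  ultimately have "bij_betw ?N (verts H - \<phi> ` C) ((`) \<phi> ` T)"
    by (simp add: bij_betw_def)
  moreover have "card (\<phi> ` C) = card C"
    using \<phi>_inj C_subset by (metis card_image inj_on_subset)
  moreover have "\<phi> ` C \<subseteq> verts H"
    using C_subset by (auto simp: verts_completion)
  ultimately show ?thesis
    using assms graph_completion FTD_admissible_no_twins[OF FTD_admissible_completion]
    unfolding is_GF_def T_eq by blast
qed

text \<open>Removing all new vertices from the completion leaves the copy of
  \<open>G\<close>.\<close>

lemma obtained_from_GF_completion:
  assumes "4 \<le> card C" and "2 ^ (card C - 1) \<le> card (verts G) + 1"
  shows "obtained_from_GF (card C) G"
proof -
  have "\<psi> ` M \<subseteq> verts H - \<phi> ` C"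
    using \<phi>_neq_\<psi> C_subset by (force simp: verts_completion)
  moreover have "card (\<psi> ` M) \<le> 2 ^ (card C - 1) - card C"
  proof -
    \<comment> \<open>With \<open>k = card C\<close> and \<open>n = card (verts G)\<close>, there
      are \<open>2 ^ k - 1 - n - k\<close> free sets; inserting
      \<open>n \<ge> 2 ^ (k - 1) - 1\<close> gives the bound.\<close>
    have "(2::nat) ^ card C = 2 * 2 ^ (card C - 1)"
      using assms(1) by (metis One_nat_def Suc_pred not_gr_zero not_numeral_le_zero power_Suc)
    then show ?thesis
      using card_free_traces[OF graph code] assms(2) card_image[OF \<psi>_inj] by linarith
  qed
  moreover have "verts H - \<psi> ` M = \<phi> ` verts G"
    using \<phi>_neq_\<psi> by (auto simp: verts_completion)
  moreover obtain h where "digraph_isomorphism h" "app_iso h G = H \<restriction> (\<phi> ` verts G)"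
    using iso_completion by blast
  \<comment> \<open>The required isomorphism runs from the copy to \<open>G\<close>, so
    \<open>h\<close> is inverted.\<close>
  then have "digraph_iso (H \<restriction> (\<phi> ` verts G)) G"
    using digraph_isomorphism_invI app_iso_inv unfolding digraph_iso_def by metis
  ultimately show ?thesis
    using completion_is_GF[OF assms(1)] FTD_admissible_completion
    unfolding obtained_from_GF_def by metis
qed

end

section \<open>From codes of size \<open>k\<close> to the characterization\<close>

lemma FTD_code_imp_obtained_from_GF:
  assumes "graph G" and "FTD_code G C" and "4 \<le> card C"
    and "2 ^ (card C - 1) \<le> card (verts G) + 1"
  shows "obtained_from_GF (card C) G"
proof -
  interpret graph G by fact
  have "finite C"
    using assms(2) finite_subset[OF _ finite_verts] by (auto simp: FTD_code_def full_separating_def)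
  then have "finite (verts G <+> free_traces G C)"
    by (simp add: free_traces_def)
  then obtain f :: "'a + 'a set \<Rightarrow> nat" where "inj_on f (verts G <+> free_traces G C)"
    by (metis finite_imp_inj_to_nat_seg)
  then interpret code_completion G C f
    using assms(1,2) by (simp add: code_completion_def)
  show ?thesis
    using assms(3,4) by (rule obtained_from_GF_completion)
qed

theorem theorem10:
  fixes G :: "('a, 'b) pre_digraph" and n k :: nat
  assumes "graph G"
    and "FTD_admissible G"
    and "n = card (verts G)"
    and "int k = 1 + \<lfloor>log 2 (real n + 1)\<rfloor>"
    and "k \<ge> 5"
  shows "gamma_FTD G = k \<longleftrightarrow> obtained_from_GF k G"
proof -
  \<comment> \<open>The floor is bounded by the logarithm, which yields
    \<open>2 ^ (k - 1) \<le> n + 1\<close>.\<close>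
  have "real (k - 1) \<le> log 2 (real n + 1)"
    using assms(4,5) by linarith
  then have "2 ^ (k - 1) \<le> real n + 1"
    by (simp add: le_log_iff powr_realpow)
  then have "real (2 ^ (k - 1)) \<le> real (n + 1)"
    by simp
  then have n: "2 ^ (k - 1) \<le> n + 1"
    by (simp only: of_nat_le_iff)
  \<comment> \<open>The counting bound at \<open>m = k - 1\<close>, which is positive as
    \<open>k \<ge> 5\<close>, gives \<open>k - 1 < card C\<close>.\<close>
  have lower: "k \<le> card C" if "FTD_code G C" for C
    using card_FTD_code_ge[OF assms(1) that, of "k - 1"] n assms(3,5) by simp
  let ?P = "\<lambda>m. \<exists>C. FTD_code G C \<and> card C = m"
  \<comment> \<open>Admissibility guarantees that the minimum is attained.\<close>
  obtain m where "?P m" using assms(2) by (auto simp: FTD_admissible_def)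
  then have attained: "?P (gamma_FTD G)"
    unfolding gamma_FTD_def by (rule LeastI)
  show ?thesis
  proof
    assume "gamma_FTD G = k"
    then obtain C where C: "FTD_code G C" "card C = k" using attained by blast
    show "obtained_from_GF k G"
      using FTD_code_imp_obtained_from_GF[OF assms(1) C(1)] C(2) assms(3,5) n by simp
  next
    assume "obtained_from_GF k G"
    then have "?P k" by (rule obtained_from_GF_imp_FTD_code)
    then have "gamma_FTD G \<le> k" unfolding gamma_FTD_def by (rule Least_le)
    then show "gamma_FTD G = k" using attained lower by (metis le_antisym)
  qed
qed

end
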